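(* Let $\mathcal H_B,\mathcal H_A,\mathcal H_E,\mathcal H_X$ be finite-dimensional complex Hilbert spaces (battery, auxiliary, environment, external), let $H_B$ be a Hermitian operator on $\mathcal H_B$, and let $\rho^2_S=\rho^2_{BAEX}$ be a density operator on $\mathcal H_B\otimes\mathcal H_A\otimes\mathcal H_E\otimes\mathcal H_X$ which is not a product state with respect to the bipartition $BAE:X$. Put $$\rho_B=\operatorname{tr}_{AEX}[\rho^2_{BAEX}],\qquad Z''=\operatorname{tr}[\rho_BH_B]\,\mathbb I_{BAEX}-H_B\otimes\mathbb I_{AEX},\qquad \mathcal B''=\operatorname{tr}_B\big[\rho^2_S\,Z''\big],$$ and let $\{\beta''_i\}_i$ be the eigenvalues of the operator $\mathcal B''$ on $\mathcal H_A\otimes\mathcal H_E\otimes\mathcal H_X$. Then the distillable energy $S^{NP_2}_D$, the maximum stochastically extractable energy $S^{NP_2}_{\max}$ and the average extractable energy $S^{NP_2}_{av}$ obtained by performing the optimal type-2 NPOVM on the auxiliary (realized by a projective measurement on $AEX$) are $$S^{NP_2}_D=\sum_{i\in\mathcal I}\beta''_i,\qquad S^{NP_2}_{\max}=\max_i\beta''_i,\qquad S^{NP_2}_{av}=\sum_i\beta''_i,$$ where $\mathcal I=\{i:\beta''_i>0\}$ is the set of indices of the positive eigenvalues.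
   Context: Eigenvalues are listed with multiplicity; an empty sum is $0$. A type-2 NPOVM (non-positive operator-valued measurement) on the auxiliary $A$ is implemented by a rank-one projective measurement on $AEX$, i.e. by an orthonormal basis $\Psi=\{|\Psi_i\rangle\}_i$ of $\mathcal H_A\otimes\mathcal H_E\otimes\mathcal H_X$. For outcome $i$, the unnormalized post-measurement state is $$\rho''^{\,3,i}_{BAEX}=(\mathbb I_B\otimes|\Psi_i\rangle\langle\Psi_i|)\,\rho^2_S\,(\mathbb I_B\otimes|\Psi_i\rangle\langle\Psi_i|),$$ its probability is $p''_i=\operatorname{tr}(\rho''^{\,3,i}_{BAEX})$, and the energy extracted from the battery, weighted by the probability, is $$s''_i(\Psi)=p''_i\operatorname{tr}[\rho_BH_B]-\operatorname{tr}\big[H_B\operatorname{tr}_{AEX}(\rho''^{\,3,i}_{BAEX})\big].$$ The three figures of merit are: - distillable energy: $S^{NP_2}_D=\max_{\Psi}\sum_{i:\,s''_i(\Psi)>0}s''_i(\Psi)$; - maximum stochastically extractable energy: $S^{NP_2}_{\max}=\max_{\Psi}\max_i s''_i(\Psi)$; - average extractable energy: $S^{NP_2}_{av}=\max_\Psi\sum_i s''_i(\Psi)$; where all maxima over $\Psi$ run over all orthonormal bases of $\mathcal H_A\otimes\mathcal H_E\otimes\mathcal H_X$. *)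

theory Defs
  imports "HOL-Analysis.Analysis" "HOL-Computational_Algebra.Polynomial"
begin

text \<open>
  A Hilbert space of dimension \<open>CARD('n)\<close> is \<open>complex ^ 'n\<close>, with operators
  \<open>complex ^ 'n ^ 'n\<close>; tensor products correspond to product index types.
  The library inner product on \<open>complex ^ 'n\<close> is the real one, hence the following.
\<close>

definition cinner :: "complex ^ 'n \<Rightarrow> complex ^ 'n \<Rightarrow> complex" where
  "cinner u v = (\<Sum>i\<in>UNIV. cnj (u $ i) * v $ i)"

definition dagger :: "complex ^ 'n ^ 'm \<Rightarrow> complex ^ 'm ^ 'n" where
  "dagger M = (\<chi> i j. cnj (M $ j $ i))"

definition hermitian :: "complex ^ 'n ^ 'n \<Rightarrow> bool" where
  "hermitian M \<longleftrightarrow> dagger M = M"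

definition density_operator :: "complex ^ 'n ^ 'n \<Rightarrow> bool" where
  "density_operator \<rho> \<longleftrightarrow>
     hermitian \<rho> \<and> (\<forall>v. 0 \<le> Re (cinner v (\<rho> *v v))) \<and> trace \<rho> = 1"

definition ketbra :: "complex ^ 'n \<Rightarrow> complex ^ 'n ^ 'n" where
  "ketbra \<psi> = (\<chi> i j. \<psi> $ i * cnj (\<psi> $ j))"

definition tensor ::
  "complex ^ 'm ^ 'm \<Rightarrow> complex ^ 'n ^ 'n \<Rightarrow> complex ^ ('m::finite \<times> 'n::finite) ^ ('m \<times> 'n)" where
  "tensor M N = (\<chi> i j. M $ fst i $ fst j * N $ snd i $ snd j)"

definition ptrace_fst :: "complex ^ ('m::finite \<times> 'n::finite) ^ ('m \<times> 'n) \<Rightarrow> complex ^ 'n ^ 'n" where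
  "ptrace_fst M = (\<chi> k l. \<Sum>b\<in>UNIV. M $ (b, k) $ (b, l))"

definition ptrace_snd :: "complex ^ ('m::finite \<times> 'n::finite) ^ ('m \<times> 'n) \<Rightarrow> complex ^ 'm ^ 'm" where
  "ptrace_snd M = (\<chi> b c. \<Sum>k\<in>UNIV. M $ (b, k) $ (c, k))"

text \<open>
  \<open>'b \<times> 'a \<times> 'e \<times> 'x\<close> associates to the right, so the bipartition \<open>BAE:X\<close> is
  written out in components.
\<close>

definition product_state_BAE_X ::
  "complex ^ ('b::finite \<times> 'a::finite \<times> 'e::finite \<times> 'x::finite) ^ ('b \<times> 'a \<times> 'e \<times> 'x) \<Rightarrow> bool" where
  "product_state_BAE_X \<rho> \<longleftrightarrow>
     (\<exists>(\<sigma> :: complex ^ ('b \<times> 'a \<times> 'e) ^ ('b \<times> 'a \<times> 'e)) (\<tau> :: complex ^ 'x ^ 'x).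
        density_operator \<sigma> \<and> density_operator \<tau> \<and>
        (\<forall>b a e x b' a' e' x'.
           \<rho> $ (b, a, e, x) $ (b', a', e', x') = \<sigma> $ (b, a, e) $ (b', a', e') * \<tau> $ x $ x'))"

definition orthonormal_basis :: "('k \<Rightarrow> complex ^ 'k) \<Rightarrow> bool" where
  "orthonormal_basis \<Psi> \<longleftrightarrow>
     (\<forall>i j. cinner (\<Psi> i) (\<Psi> j) = (if i = j then 1 else 0)) \<and> vec.span (range \<Psi>) = UNIV"

definition charpoly :: "complex ^ 'n ^ 'n \<Rightarrow> complex poly" where
  "charpoly M = det (\<chi> i j. (if i = j then [:0, 1:] else 0) - [:M $ i $ j:])"

text \<open>
  \<open>\<beta>\<close> lists the eigenvalues of \<open>M\<close> with algebraic multiplicity. Such a listing exists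
  for every \<open>M\<close>, and it is unique up to a permutation of the indices.
\<close>

definition lists_eigenvalues :: "complex ^ 'n ^ 'n \<Rightarrow> ('n \<Rightarrow> complex) \<Rightarrow> bool" where
  "lists_eigenvalues M \<beta> \<longleftrightarrow> charpoly M = (\<Prod>i\<in>UNIV. [:- \<beta> i, 1:])"

text \<open>Below, \<open>'b\<close> indexes the battery \<open>B\<close> and \<open>'k\<close> the measured system \<open>AEX\<close>.\<close>

definition battery_state :: "complex ^ ('b::finite \<times> 'k::finite) ^ ('b \<times> 'k) \<Rightarrow> complex ^ 'b ^ 'b" where
  "battery_state \<rho> = ptrace_snd \<rho>"

definition post_measurement ::
  "complex ^ ('b::finite \<times> 'k::finite) ^ ('b \<times> 'k) \<Rightarrow> complex ^ 'k \<Rightarrow> complex ^ ('b::finite \<times> 'k::finite) ^ ('b \<times> 'k)" where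
  "post_measurement \<rho> \<psi> =
     tensor (mat 1) (ketbra \<psi>) ** \<rho> ** tensor (mat 1) (ketbra \<psi>)"

text \<open>For Hermitian \<open>\<rho>\<close> and \<open>H\<close> all traces below are real, so \<open>Re\<close> only changes the type.\<close>

definition extracted_energy ::
  "complex ^ ('b::finite \<times> 'k::finite) ^ ('b \<times> 'k) \<Rightarrow> complex ^ 'b ^ 'b \<Rightarrow> ('k \<Rightarrow> complex ^ 'k) \<Rightarrow> 'k \<Rightarrow> real" where
  "extracted_energy \<rho> H \<Psi> i =
     Re (trace (post_measurement \<rho> (\<Psi> i)) * trace (battery_state \<rho> ** H)
         - trace (H ** ptrace_snd (post_measurement \<rho> (\<Psi> i))))"

definition distillable_values ::
  "complex ^ ('b::finite \<times> 'k::finite) ^ ('b \<times> 'k) \<Rightarrow> complex ^ 'b ^ 'b \<Rightarrow> real set" where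
  "distillable_values \<rho> H =
     {\<Sum>i | 0 < extracted_energy \<rho> H \<Psi> i. extracted_energy \<rho> H \<Psi> i | \<Psi>. orthonormal_basis \<Psi>}"

definition stochastic_values ::
  "complex ^ ('b::finite \<times> 'k::finite) ^ ('b \<times> 'k) \<Rightarrow> complex ^ 'b ^ 'b \<Rightarrow> real set" where
  "stochastic_values \<rho> H = {Max (range (extracted_energy \<rho> H \<Psi>)) | \<Psi>. orthonormal_basis \<Psi>}"

definition average_values ::
  "complex ^ ('b::finite \<times> 'k::finite) ^ ('b \<times> 'k) \<Rightarrow> complex ^ 'b ^ 'b \<Rightarrow> real set" where
  "average_values \<rho> H = {\<Sum>i\<in>UNIV. extracted_energy \<rho> H \<Psi> i | \<Psi>. orthonormal_basis \<Psi>}"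

text \<open>
  The three figures of merit are maxima over infinite sets. \<open>Greatest\<close> is only
  meaningful when the maximum is attained, which \<open>has_maximum\<close> expresses.
\<close>

definition has_maximum :: "real set \<Rightarrow> bool" where
  "has_maximum A \<longleftrightarrow> (\<exists>m\<in>A. \<forall>x\<in>A. x \<le> m)"

definition S_NP2_D :: "complex ^ ('b::finite \<times> 'k::finite) ^ ('b \<times> 'k) \<Rightarrow> complex ^ 'b ^ 'b \<Rightarrow> real" where
  "S_NP2_D \<rho> H = (GREATEST s. s \<in> distillable_values \<rho> H)"

definition S_NP2_max :: "complex ^ ('b::finite \<times> 'k::finite) ^ ('b \<times> 'k) \<Rightarrow> complex ^ 'b ^ 'b \<Rightarrow> real" where
  "S_NP2_max \<rho> H = (GREATEST s. s \<in> stochastic_values \<rho> H)"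

definition S_NP2_av :: "complex ^ ('b::finite \<times> 'k::finite) ^ ('b \<times> 'k) \<Rightarrow> complex ^ 'b ^ 'b \<Rightarrow> real" where
  "S_NP2_av \<rho> H = (GREATEST s. s \<in> average_values \<rho> H)"

text \<open>The library matrix \<open>mat c\<close> is \<open>c\<close> times the identity.\<close>

definition Z_op ::
  "complex ^ ('b::finite \<times> 'k::finite) ^ ('b \<times> 'k) \<Rightarrow> complex ^ 'b ^ 'b \<Rightarrow> complex ^ ('b::finite \<times> 'k::finite) ^ ('b \<times> 'k)" where
  "Z_op \<rho> H = mat (trace (battery_state \<rho> ** H)) - tensor H (mat 1)"

definition B_op ::
  "complex ^ ('b::finite \<times> 'k::finite) ^ ('b \<times> 'k) \<Rightarrow> complex ^ 'b ^ 'b \<Rightarrow> complex ^ 'k ^ 'k" where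
  "B_op \<rho> H = ptrace_fst (\<rho> ** Z_op \<rho> H)"

end

theory Submission
  imports Defs
begin

text \<open>
  Since \<open>H\<^sub>B \<otimes> 1\<close> commutes with the projector \<open>1 \<otimes> |\<psi>\<rangle>\<langle>\<psi>|\<close>, the energy extracted by the outcome
  \<open>\<psi>\<close> is \<open>\<langle>\<psi>, B \<psi>\<rangle>\<close>, where the operator \<open>B\<close> is Hermitian because the partial trace over the
  battery is cyclic for operators that act on the battery only. Expanding \<open>\<psi>\<close> in an orthonormal
  eigenbasis of \<open>B\<close> turns the energies of an arbitrary basis into averages of the eigenvalues with
  doubly stochastic weights, so the eigenbasis is optimal for all three figures of merit at once.
\<close>

section \<open>The complex inner product\<close>

lemma cinner_add_right: "cinner u (v + w) = cinner u v + cinner u w"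
  by (simp add: cinner_def distrib_left sum.distrib)

lemma cinner_diff_right: "cinner u (v - w) = cinner u v - cinner u w"
  by (simp add: cinner_def right_diff_distrib sum_subtractf)

lemma cinner_scale_right: "cinner u (c *s v) = c * cinner u v"
  by (simp add: cinner_def sum_distrib_left mult_ac)

lemma cinner_add_left: "cinner (u + v) w = cinner u w + cinner v w"
  by (simp add: cinner_def distrib_right sum.distrib)

lemma cinner_scale_left: "cinner (c *s u) v = cnj c * cinner u v"
  by (simp add: cinner_def sum_distrib_left mult_ac)

lemma cnj_cinner: "cnj (cinner u v) = cinner v u"
  by (simp add: cinner_def mult_ac)

lemma cmod_square: "(complex_of_real (cmod z))\<^sup>2 = z * cnj z"
  by (metis complex_norm_square of_real_power)

lemma cinner_self: "cinner v v = of_real ((norm v)\<^sup>2)"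
proof -
  have "(norm v)\<^sup>2 = (\<Sum>i\<in>UNIV. (cmod (v $ i))\<^sup>2)"
    by (simp add: norm_vec_def L2_set_def sum_nonneg)
  then show ?thesis
    by (simp add: cinner_def cmod_square mult.commute)
qed

section \<open>Hermitian matrices and their orthonormal eigenvectors\<close>

lemma hermitian_cinner:
  assumes "hermitian M"
  shows "cinner u (M *v v) = cinner (M *v u) v"
proof -
  have M: "cnj (M $ i $ j) = M $ j $ i" for i j
    using assms by (auto simp: hermitian_def dagger_def vec_eq_iff)
  have "cinner u (M *v v) = (\<Sum>i\<in>UNIV. \<Sum>j\<in>UNIV. cnj (u $ i) * (M $ i $ j * v $ j))"
    by (simp add: cinner_def matrix_vector_mult_def sum_distrib_left)
  also have "\<dots> = (\<Sum>j\<in>UNIV. \<Sum>i\<in>UNIV. cnj (u $ i) * (M $ i $ j * v $ j))"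
    by (rule sum.swap)
  also have "\<dots> = cinner (M *v u) v"
    by (simp add: cinner_def matrix_vector_mult_def sum_distrib_left sum_distrib_right M mult_ac)
  finally show ?thesis .
qed

text \<open>The orthogonality conditions form a square linear system. The index \<open>k\<close>
  outside \<open>T\<close> contributes a zero row, so the system is singular and has a nonzero
  kernel vector.\<close>

lemma exists_nonzero_orthogonal:
  fixes \<Phi> :: "'k::finite \<Rightarrow> complex ^ 'k"
  assumes "k \<notin> T"
  obtains v where "v \<noteq> 0" "\<And>i. i \<in> T \<Longrightarrow> cinner (\<Phi> i) v = 0"
proof -
  define A :: "complex ^ 'k ^ 'k"
    where "A = (\<chi> i j. if i \<in> T then cnj (\<Phi> i $ j) else 0)"
  have "row k A = 0"
    using assms by (simp add: A_def row_def vec_eq_iff)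
  then have "det A = 0"
    by (rule det_zero_row)
  then have "\<not> (\<exists>B. B ** A = mat 1)"
    by (metis invertible_det_nz invertible_left_inverse)
  then obtain v where v: "v \<noteq> 0" "A *v v = 0"
    by (auto simp: matrix_left_invertible_ker)
  have "cinner (\<Phi> i) v = 0" if "i \<in> T" for i
  proof -
    have "(A *v v) $ i = cinner (\<Phi> i) v"
      using that by (simp add: A_def matrix_vector_mult_def cinner_def)
    then show ?thesis using v by simp
  qed
  then show ?thesis using v that by blast
qed

text \<open>
  A maximiser of the quadratic form on the unit sphere of the orthogonal complement is an
  eigenvector: otherwise moving in the direction of the residual \<open>w\<close> would increase the form.
\<close>

lemma hermitian_eigenvector_orthogonal:
  fixes M :: "complex ^ 'k::finite ^ 'k" and T :: "'k set"
  assumes M: "hermitian M"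
    and eig: "\<And>i. i \<in> T \<Longrightarrow> M *v \<Phi> i = of_real (l i) *s \<Phi> i"
    and k: "k \<notin> T"
  obtains v and c :: real where "cinner v v = 1" "\<And>i. i \<in> T \<Longrightarrow> cinner (\<Phi> i) v = 0"
    "M *v v = of_real c *s v"
proof -
  define W where "W = {v. \<forall>i\<in>T. cinner (\<Phi> i) v = 0}"
  define f where "f v = Re (cinner v (M *v v))" for v
  have scale: "f (of_real t *s v) = t\<^sup>2 * f v" for t v
    by (simp add: f_def matrix_vector_mult_scaleR vector_scalar_commute cinner_scale_left cinner_scale_right power2_eq_square mult.assoc)
  have cont: "continuous_on S f" for S
    unfolding f_def cinner_def matrix_vector_mult_def
    by (auto intro!: continuous_intros)
  have "closed W"
  proof -
    have "W = (\<Inter>i\<in>T. {v. cinner (\<Phi> i) v = 0})" by (auto simp: W_def)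
    moreover have "closed {v. cinner (\<Phi> i) v = 0}" for i
      unfolding cinner_def by (intro closed_Collect_eq continuous_intros)
    ultimately show ?thesis by auto
  qed
  have unit: "of_real (1 / norm v) *s v \<in> W \<inter> sphere 0 1" if "v \<in> W" "v \<noteq> 0" for v
  proof -
    have "cinner (of_real (1 / norm v) *s v) (of_real (1 / norm v) *s v) = 1"
      using that unfolding cinner_scale_left cinner_scale_right
      by (simp add: cinner_self power2_eq_square)
    then have "(norm (of_real (1 / norm v) *s v))\<^sup>2 = 1"
      by (metis cinner_self of_real_eq_1_iff)
    then have "norm (of_real (1 / norm v) *s v) = 1"
      by (simp add: abs_square_eq_1)
    then show ?thesis
      using that by (simp add: W_def cinner_scale_right)
  qed
  obtain v0 where "v0 \<noteq> 0" and v0: "\<And>i. i \<in> T \<Longrightarrow> cinner (\<Phi> i) v0 = 0"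
    using exists_nonzero_orthogonal[OF k] by blast
  then have nonempty: "W \<inter> sphere 0 1 \<noteq> {}"
    using unit[of v0] unfolding W_def by blast
  have compact: "compact (W \<inter> sphere 0 1)"
    using \<open>closed W\<close> by (intro closed_Int_compact compact_sphere)
  obtain v where "v \<in> W \<inter> sphere 0 1" and max: "\<And>u. u \<in> W \<inter> sphere 0 1 \<Longrightarrow> f u \<le> f v"
    using continuous_attains_sup[OF compact nonempty cont] by blast
  then have v: "v \<in> W" "norm v = 1"
    by auto
  \<comment> \<open>\<open>f\<close> is homogeneous of degree two, so maximality on the unit sphere
    extends to all of \<open>W\<close>, where competitors need not be normalized.\<close>
  have bound: "f u \<le> f v * (norm u)\<^sup>2" if "u \<in> W" for u
  proof (cases "u = 0")
    case True
    then show ?thesis by (simp add: f_def cinner_def)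
  next
    case False
    have "(1 / norm u)\<^sup>2 * f u \<le> f v"
      using max[OF unit[OF that False]] by (simp only: scale)
    then show ?thesis using False by (simp add: field_simps)
  qed
  define w where "w = M *v v - of_real (f v) *s v"
  \<comment> \<open>\<open>M\<close> maps \<open>W\<close> into itself: it is Hermitian and each
    \<open>\<Phi> i\<close> with \<open>i\<close> in \<open>T\<close> is an eigenvector, so
    <\<open>\<Phi> i\<close>, \<open>M *v v\<close>> is a multiple of <\<open>\<Phi> i\<close>,
    \<open>v\<close>> = 0.\<close>
  have "w \<in> W"
    using v eig by (auto simp: W_def w_def cinner_diff_right cinner_scale_right
        hermitian_cinner[OF M] cinner_scale_left)
  define a b where "a = (norm w)\<^sup>2" and "b = f w - f v * (norm w)\<^sup>2"
  have quadratic: "2 * t * a + t\<^sup>2 * b \<le> 0" for t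
  proof -
    have u: "v + of_real t *s w \<in> W"
      using v \<open>w \<in> W\<close> by (simp add: W_def cinner_add_right cinner_scale_right)
    have norm_u: "(norm (v + of_real t *s w))\<^sup>2 = 1 + 2 * t * Re (cinner w v) + t\<^sup>2 * (norm w)\<^sup>2"
    proof -
      have "(norm (v + of_real t *s w))\<^sup>2 = Re (cinner (v + of_real t *s w) (v + of_real t *s w))"
        by (simp add: cinner_self)
      also have "\<dots> = Re (cinner v v) + 2 * t * Re (cinner w v) + t\<^sup>2 * Re (cinner w w)"
        using cnj_cinner[of w v, symmetric]
        by (simp add: cinner_add_left cinner_add_right cinner_scale_left cinner_scale_right
            power2_eq_square algebra_simps)
      finally show ?thesis using v by (simp add: cinner_self)
    qed
    have "f (v + of_real t *s w) = f v + 2 * t * Re (cinner w (M *v v)) + t\<^sup>2 * f w"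
    proof -
      have "cinner v (M *v w) = cnj (cinner w (M *v v))"
        by (simp add: cnj_cinner hermitian_cinner[OF M])
      then show ?thesis
        by (simp add: f_def matrix_vector_right_distrib vector_scalar_commute cinner_add_left
            cinner_add_right cinner_scale_left cinner_scale_right power2_eq_square algebra_simps)
    qed
    moreover have "Re (cinner w (M *v v)) = a + f v * Re (cinner w v)"
    proof -
      have "a = Re (cinner w w)" by (simp add: a_def cinner_self)
      also have "cinner w w = cinner w (M *v v) - of_real (f v) * cinner w v"
        by (subst (2) w_def) (simp add: cinner_diff_right cinner_scale_right)
      finally show ?thesis by simp
    qed
    ultimately have "2 * t * a + t\<^sup>2 * b
        = f (v + of_real t *s w) - f v * (norm (v + of_real t *s w))\<^sup>2"
      by (simp add: norm_u b_def algebra_simps)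
    then show ?thesis
      using bound[OF u] by simp
  qed
  have "a = 0"
  proof (rule ccontr)
    assume "a \<noteq> 0"
    then have a: "a > 0" by (simp add: a_def)
    \<comment> \<open>With this step size \<open>t * \<bar>b\<bar> \<le> a\<close>, hence
      \<open>2 * a + t * b \<ge> a > 0\<close>, against \<open>quadratic\<close>. The summand 1
      keeps the denominator positive when \<open>b = 0\<close>.\<close>
    define t where "t = a / (\<bar>b\<bar> + 1)"
    have t: "t > 0" using a by (simp add: t_def add_nonneg_pos)
    have "t * (2 * a + t * b) \<le> 0"
      using quadratic[of t] by (simp add: power2_eq_square algebra_simps)
    then have "2 * a + t * b \<le> 0"
      using t by (simp add: mult_le_0_iff)
    moreover have "t * \<bar>b\<bar> \<le> a"
      using a by (simp add: t_def field_simps)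
    moreover have "- (t * b) \<le> t * \<bar>b\<bar>"
      using t abs_ge_minus_self[of "t * b"] by (simp add: abs_mult)
    ultimately show False using a by linarith
  qed
  then have "M *v v = of_real (f v) *s v"
    by (simp add: a_def w_def)
  moreover have "cinner v v = 1"
    using v by (simp add: cinner_self)
  ultimately show ?thesis
    using that v by (auto simp: W_def)
qed

text \<open>Restricting to an index set \<open>T\<close> allows an eigenbasis to be built one vector
  at a time. The number of indices need not match the dimension.\<close>

definition orthonormal_on :: "'k set \<Rightarrow> ('k \<Rightarrow> complex ^ 'n) \<Rightarrow> bool" where
  "orthonormal_on T \<Phi> \<longleftrightarrow>
     (\<forall>i\<in>T. \<forall>j\<in>T. cinner (\<Phi> i) (\<Phi> j) = (if i = j then 1 else 0))"

text \<open>Induction on \<open>T\<close>: each new index receives a unit eigenvector from the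
  orthogonal complement of those already chosen. \<open>T = UNIV\<close> gives a full
  eigenbasis.\<close>

lemma hermitian_orthonormal_eigenvectors:
  fixes M :: "complex ^ 'k::finite ^ 'k" and T :: "'k set"
  assumes "hermitian M"
  shows "\<exists>\<Phi> (l :: 'k \<Rightarrow> real). orthonormal_on T \<Phi> \<and> (\<forall>i\<in>T. M *v \<Phi> i = of_real (l i) *s \<Phi> i)"
  using finite[of T]
proof (induction T rule: finite_induct)
  case empty
  show ?case by (simp add: orthonormal_on_def)
next
  case (insert k T)
  then obtain \<Phi> and l :: "'k \<Rightarrow> real" where \<Phi>: "orthonormal_on T \<Phi>"
    and l: "\<And>i. i \<in> T \<Longrightarrow> M *v \<Phi> i = of_real (l i) *s \<Phi> i" by blast
  obtain v and c :: real where v: "cinner v v = 1" "\<And>i. i \<in> T \<Longrightarrow> cinner (\<Phi> i) v = 0"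
    and c: "M *v v = of_real c *s v"
    using hermitian_eigenvector_orthogonal[of M T \<Phi> l k] assms l insert.hyps(2) by blast
  have v': "cinner v (\<Phi> i) = 0" if "i \<in> T" for i
    using v(2)[OF that] cnj_cinner[of "\<Phi> i" v] by simp
  have "orthonormal_on (insert k T) (\<Phi>(k := v))"
    using \<Phi> v v' insert.hyps(2) by (auto simp: orthonormal_on_def)
  moreover have "\<forall>i\<in>insert k T. M *v (\<Phi>(k := v)) i = of_real ((l(k := c)) i) *s (\<Phi>(k := v)) i"
    using l c insert.hyps(2) by auto
  ultimately show ?case by blast
qed

section \<open>Orthonormal bases, Parseval's identity and spectral expansion\<close>

lemma orthonormal_unitary:
  fixes \<Phi> :: "'k::finite \<Rightarrow> complex ^ 'k"
  assumes "orthonormal_on UNIV \<Phi>"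
  defines "U \<equiv> \<chi> i j. \<Phi> j $ i"
  shows "dagger U ** U = mat 1" "U ** dagger U = mat 1"
proof -
  show "dagger U ** U = mat 1"
    using assms(1)
    by (simp add: vec_eq_iff matrix_matrix_mult_def U_def dagger_def mat_def orthonormal_on_def cinner_def)
  then show "U ** dagger U = mat 1"
    by (simp add: matrix_left_right_inverse)
qed

text \<open>This is the resolution of the identity \<open>U ** dagger U = mat 1\<close> applied to
  \<open>v\<close>, where the columns of \<open>U\<close> are the basis vectors.\<close>

lemma orthonormal_expansion:
  fixes \<Phi> :: "'k::finite \<Rightarrow> complex ^ 'k"
  assumes "orthonormal_on UNIV \<Phi>"
  shows "v = (\<Sum>j\<in>UNIV. cinner (\<Phi> j) v *s \<Phi> j)"
proof -
  define U :: "complex ^ 'k ^ 'k" where "U = (\<chi> i j. \<Phi> j $ i)"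
  have "v = U *v (dagger U *v v)"
    using orthonormal_unitary(2)[OF assms] by (simp add: U_def matrix_vector_mul_assoc)
  also have "\<dots> = (\<Sum>j\<in>UNIV. cinner (\<Phi> j) v *s \<Phi> j)"
    by (simp add: vec_eq_iff U_def matrix_vector_mult_def dagger_def cinner_def mult.commute)
  finally show ?thesis .
qed

text \<open>As many orthonormal vectors as the dimension span the space, so the spanning clause
  follows from orthonormality.\<close>

lemma orthonormal_basis_iff: "orthonormal_basis \<Phi> \<longleftrightarrow> orthonormal_on UNIV \<Phi>"
proof
  assume on: "orthonormal_on UNIV \<Phi>"
  have "v \<in> vec.span (range \<Phi>)" for v
    by (subst orthonormal_expansion[OF on])
       (intro vec.span_sum vec.span_scale vec.span_base, simp)
  with on show "orthonormal_basis \<Phi>"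
    by (auto simp: orthonormal_basis_def orthonormal_on_def)
qed (auto simp: orthonormal_basis_def orthonormal_on_def)

lemma cinner_sum_right: "cinner u (sum g S) = (\<Sum>j\<in>S. cinner u (g j))"
  by (induction S rule: infinite_finite_induct)
     (auto simp: cinner_add_right, simp_all add: cinner_def)

lemma cinner_parseval:
  fixes \<Phi> :: "'k::finite \<Rightarrow> complex ^ 'k"
  assumes "orthonormal_on UNIV \<Phi>"
  shows "cinner u v = (\<Sum>j\<in>UNIV. cinner u (\<Phi> j) * cinner (\<Phi> j) v)"
  by (subst orthonormal_expansion[OF assms, of v])
     (simp add: cinner_sum_right cinner_scale_right mult.commute)

text \<open>Parseval's identity with \<open>u = v\<close>. Applied to either of two bases, it gives
  the row sums and the column sums of their overlap matrix.\<close>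

lemma sum_cmod_cinner:
  fixes \<Phi> :: "'k::finite \<Rightarrow> complex ^ 'k"
  assumes "orthonormal_on UNIV \<Phi>" "cinner v v = 1"
  shows "(\<Sum>j\<in>UNIV. (cmod (cinner (\<Phi> j) v))\<^sup>2) = 1"
proof -
  have "cinner v v = of_real (\<Sum>j\<in>UNIV. (cmod (cinner (\<Phi> j) v))\<^sup>2)"
    by (subst cinner_parseval[OF assms(1)])
       (simp add: cmod_square cnj_cinner mult.commute)
  then show ?thesis
    using assms(2) by (metis of_real_eq_1_iff)
qed

lemma cinner_spectral:
  fixes \<Phi> :: "'k::finite \<Rightarrow> complex ^ 'k"
  assumes "hermitian M" "orthonormal_on UNIV \<Phi>"
    and "\<And>i. M *v \<Phi> i = of_real (l i) *s \<Phi> i"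
  shows "cinner v (M *v v) = of_real (\<Sum>j\<in>UNIV. l j * (cmod (cinner (\<Phi> j) v))\<^sup>2)"
  by (subst cinner_parseval[OF assms(2)])
     (simp add: hermitian_cinner[OF assms(1), of "\<Phi> _" v] assms(3) cinner_scale_left
       cmod_square cnj_cinner mult_ac)

section \<open>The characteristic polynomial and listings of eigenvalues\<close>

lemma poly_charpoly:
  fixes M :: "complex ^ 'n::finite ^ 'n"
  shows "poly (charpoly M) x = det (mat x - M)"
proof -
  \<comment> \<open>Evaluation at \<open>x\<close> is a ring homomorphism, so it passes through the
    Leibniz formula for the determinant.\<close>
  have "poly (det A) x = det (\<chi> i j. poly (A $ i $ j) x)" for A :: "complex poly ^ 'n ^ 'n"
    by (simp add: det_def poly_sum poly_prod)
  then show ?thesis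
    by (simp add: charpoly_def) (auto simp: mat_def vec_eq_iff intro!: arg_cong[where f = det])
qed

text \<open>The unitary \<open>U\<close> of eigenvectors diagonalizes \<open>mat x - M\<close> for
  every \<open>x\<close>. The two polynomials therefore agree at all complex points and are
  equal.\<close>

lemma lists_eigenvalues_orthonormal:
  fixes \<Phi> :: "'k::finite \<Rightarrow> complex ^ 'k"
  assumes on: "orthonormal_on UNIV \<Phi>"
    and eig: "\<And>i. M *v \<Phi> i = c i *s \<Phi> i"
  shows "lists_eigenvalues M c"
proof -
  define U :: "complex ^ 'k ^ 'k" where "U = (\<chi> i j. \<Phi> j $ i)"
  have U: "U ** dagger U = mat 1"
    using orthonormal_unitary(2)[OF on] by (simp add: U_def)
  have "poly (charpoly M) x = poly (\<Prod>i\<in>UNIV. [:- c i, 1:]) x" for x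
  proof -
    define D :: "complex ^ 'k ^ 'k" where "D = (\<chi> i j. if i = j then x - c i else 0)"
    have "(mat x - M) ** U = U ** D"
    proof -
      have "((mat x - M) ** U) $ i $ j = (U ** D) $ i $ j" for i j
      proof -
        have "((mat x - M) ** U) $ i $ j = x * \<Phi> j $ i - (M *v \<Phi> j) $ i"
          by (simp add: matrix_matrix_mult_def matrix_vector_mult_def U_def mat_def
              left_diff_distrib sum_subtractf if_distrib[of "\<lambda>a. a * _"] cong: if_cong)
        also have "\<dots> = (U ** D) $ i $ j"
          by (simp add: eig matrix_matrix_mult_def U_def D_def algebra_simps
              if_distrib[of "\<lambda>a. _ * a"] cong: if_cong)
        finally show ?thesis .
      qed
      then show ?thesis by (simp add: vec_eq_iff)
    qed
    then have "det (mat x - M) * det U = det U * det D"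
      by (metis det_mul)
    moreover have "det U \<noteq> 0"
      using arg_cong[OF U, of det] by (auto simp: det_mul)
    ultimately have "det (mat x - M) = det D" by simp
    also have "\<dots> = (\<Prod>i\<in>UNIV. x - c i)"
      by (subst det_diagonal) (auto simp: D_def)
    finally show ?thesis
      by (simp add: poly_charpoly poly_prod)
  qed
  then show ?thesis
    unfolding lists_eigenvalues_def by (metis poly_eq_poly_eq_iff ext)
qed

text \<open>Both listings are the multiset of roots of the same polynomial. Equality of multisets is
  the right notion, since the indexing may be permuted.\<close>

lemma lists_eigenvalues_unique:
  assumes "lists_eigenvalues M b" "lists_eigenvalues M c"
  shows "image_mset b (mset_set UNIV) = image_mset c (mset_set UNIV)"
proof -
  have proots: "proots (\<Prod>i\<in>A. [:- b i, 1:]) = image_mset b (mset_set A)"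
    if "finite A" for A :: "'n set" and b :: "'n \<Rightarrow> complex"
    using that
  proof (induction A rule: finite_induct)
    case (insert i A)
    then show ?case by (simp add: proots_mult proots_linear_factor del: mult_pCons_left)
  qed simp
  show ?thesis
    using assms proots[of UNIV b] proots[of UNIV c] by (simp add: lists_eigenvalues_def)
qed

section \<open>Tensor products and partial traces\<close>

lemma sum_UNIV_prod:
  fixes g :: "'m::finite \<times> 'n::finite \<Rightarrow> complex"
  shows "sum g UNIV = (\<Sum>b\<in>UNIV. \<Sum>k\<in>UNIV. g (b, k))"
  by (simp add: sum.cartesian_product)

lemma dagger_mult: "dagger (A ** B) = dagger B ** dagger A"
  by (simp add: dagger_def matrix_matrix_mult_def vec_eq_iff mult.commute)

lemma cnj_trace_hermitian:
  assumes "hermitian A" "hermitian B"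
  shows "cnj (trace (A ** B)) = trace (A ** B)"
proof -
  have "cnj (trace (A ** B)) = trace (dagger (A ** B))"
    by (simp add: trace_def dagger_def)
  also have "\<dots> = trace (B ** A)"
    using assms by (simp add: dagger_mult hermitian_def)
  also have "\<dots> = trace (A ** B)"
    by (rule trace_mul_sym)
  finally show ?thesis .
qed

lemma hermitian_ptrace_snd: "hermitian \<rho> \<Longrightarrow> hermitian (ptrace_snd \<rho>)"
  by (simp add: hermitian_def dagger_def ptrace_snd_def vec_eq_iff)

lemma tensor_mult: "tensor A B ** tensor C D = tensor (A ** C) (B ** D)"
  by (auto simp: tensor_def matrix_matrix_mult_def vec_eq_iff sum_UNIV_prod sum_product mult_ac)

lemma tensor_one_left_mult:
  "(X ** tensor (mat 1) N) $ i $ (c, l) = (\<Sum>k\<in>UNIV. X $ i $ (c, k) * N $ k $ l)"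
proof -
  have "(X ** tensor (mat 1) N) $ i $ (c, l)
      = (\<Sum>b\<in>UNIV. \<Sum>k\<in>UNIV. X $ i $ (b, k) * ((if b = c then 1 else 0) * N $ k $ l))"
    by (simp add: matrix_matrix_mult_def tensor_def mat_def sum_UNIV_prod)
  also have "\<dots> = (\<Sum>b\<in>UNIV. if b = c then \<Sum>k\<in>UNIV. X $ i $ (b, k) * N $ k $ l else 0)"
    by (intro sum.cong) auto
  finally show ?thesis by simp
qed

lemma tensor_one_right_mult:
  "(tensor A (mat 1) ** X) $ (b, k) $ j = (\<Sum>c\<in>UNIV. A $ b $ c * X $ (c, k) $ j)"
proof -
  have "(tensor A (mat 1) ** X) $ (b, k) $ j
      = (\<Sum>c\<in>UNIV. \<Sum>l\<in>UNIV. A $ b $ c * (if k = l then 1 else 0) * X $ (c, l) $ j)"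
    by (simp add: matrix_matrix_mult_def tensor_def mat_def sum_UNIV_prod)
  also have "\<dots> = (\<Sum>c\<in>UNIV. \<Sum>l\<in>UNIV. if k = l then A $ b $ c * X $ (c, l) $ j else 0)"
    by (intro sum.cong) auto
  finally show ?thesis by simp
qed

lemma mult_tensor_one_right:
  "(X ** tensor A (mat 1)) $ i $ (c, l) = (\<Sum>b\<in>UNIV. X $ i $ (b, l) * A $ b $ c)"
proof -
  have "(X ** tensor A (mat 1)) $ i $ (c, l)
      = (\<Sum>b\<in>UNIV. \<Sum>k\<in>UNIV. X $ i $ (b, k) * (A $ b $ c * (if k = l then 1 else 0)))"
    by (simp add: matrix_matrix_mult_def tensor_def mat_def sum_UNIV_prod)
  also have "\<dots> = (\<Sum>b\<in>UNIV. \<Sum>k\<in>UNIV. if k = l then X $ i $ (b, k) * A $ b $ c else 0)"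
    by (intro sum.cong) auto
  finally show ?thesis by simp
qed

text \<open>A partial trace is not cyclic in general. Here one factor acts only on the system traced
  out, and exchanging the two battery sums suffices.\<close>

lemma ptrace_fst_tensor_cyclic:
  "ptrace_fst (tensor A (mat 1) ** X) = ptrace_fst (X ** tensor A (mat 1))"
proof -
  have "(\<Sum>b\<in>UNIV. \<Sum>c\<in>UNIV. A $ b $ c * X $ (c, k) $ (b, l))
      = (\<Sum>b\<in>UNIV. \<Sum>c\<in>UNIV. X $ (b, k) $ (c, l) * A $ c $ b)" for k l
    by (subst sum.swap) (simp add: mult.commute)
  then show ?thesis
    by (simp add: ptrace_fst_def vec_eq_iff tensor_one_right_mult mult_tensor_one_right)
qed

lemma trace_mult_ptrace_snd: "trace (H ** ptrace_snd X) = trace (tensor H (mat 1) ** X)"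
proof -
  have "trace (H ** ptrace_snd X)
      = (\<Sum>b\<in>UNIV. \<Sum>c\<in>UNIV. \<Sum>k\<in>UNIV. H $ b $ c * X $ (c, k) $ (b, k))"
    by (simp add: trace_def matrix_matrix_mult_def ptrace_snd_def sum_distrib_left)
  also have "\<dots> = (\<Sum>b\<in>UNIV. \<Sum>k\<in>UNIV. \<Sum>c\<in>UNIV. H $ b $ c * X $ (c, k) $ (b, k))"
    by (intro sum.cong refl sum.swap)
  also have "\<dots> = trace (tensor H (mat 1) ** X)"
    by (simp add: trace_def sum_UNIV_prod tensor_one_right_mult)
  finally show ?thesis .
qed

text \<open>Measuring only the second factor sees only the operator reduced to that factor; this is
  what turns a trace into a quadratic form.\<close>

lemma trace_tensor_ketbra:
  "trace (X ** tensor (mat 1) (ketbra v)) = cinner v (ptrace_fst X *v v)"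
proof -
  let ?t = "\<lambda>b k l. X $ (b, k) $ (b, l) * (v $ l * cnj (v $ k))"
  have "trace (X ** tensor (mat 1) (ketbra v)) = (\<Sum>b\<in>UNIV. \<Sum>k\<in>UNIV. \<Sum>l\<in>UNIV. ?t b k l)"
    by (simp add: trace_def sum_UNIV_prod tensor_one_left_mult ketbra_def)
  also have "\<dots> = (\<Sum>k\<in>UNIV. \<Sum>b\<in>UNIV. \<Sum>l\<in>UNIV. ?t b k l)"
    by (rule sum.swap)
  also have "\<dots> = (\<Sum>k\<in>UNIV. \<Sum>l\<in>UNIV. \<Sum>b\<in>UNIV. ?t b k l)"
    by (intro sum.cong refl sum.swap)
  also have "\<dots> = cinner v (ptrace_fst X *v v)"
    by (simp add: cinner_def matrix_vector_mult_def ptrace_fst_def sum_distrib_left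
        sum_distrib_right mult_ac)
  finally show ?thesis .
qed

lemma mat_mult: "mat (c :: complex) ** X = (\<chi> i j. c * X $ i $ j)"
proof -
  have "(\<Sum>k\<in>UNIV. (if i = k then c else 0) * X $ k $ j)
      = (\<Sum>k\<in>UNIV. if i = k then c * X $ k $ j else 0)" for i j
    by (intro sum.cong) auto
  then show ?thesis
    by (simp add: matrix_matrix_mult_def mat_def vec_eq_iff)
qed

lemma mult_mat: "X ** mat (c :: complex) = (\<chi> i j. c * X $ i $ j)"
proof -
  have "(\<Sum>k\<in>UNIV. X $ i $ k * (if k = j then c else 0))
      = (\<Sum>k\<in>UNIV. if k = j then c * X $ i $ k else 0)" for i j
    by (intro sum.cong) auto
  then show ?thesis
    by (simp add: matrix_matrix_mult_def mat_def vec_eq_iff)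
qed

lemma matrix_mult_diff_right: "A ** (B - C) = A ** B - A ** (C :: complex ^ _ ^ _)"
  by (simp add: matrix_matrix_mult_def vec_eq_iff right_diff_distrib sum_subtractf)

lemma matrix_mult_diff_left: "(A - B) ** C = A ** C - B ** (C :: complex ^ _ ^ _)"
  by (simp add: matrix_matrix_mult_def vec_eq_iff left_diff_distrib sum_subtractf)

lemma ptrace_fst_diff: "ptrace_fst (X - Y) = ptrace_fst X - ptrace_fst Y"
  by (simp add: ptrace_fst_def vec_eq_iff sum_subtractf)

lemma ptrace_fst_dagger: "dagger (ptrace_fst X) = ptrace_fst (dagger X)"
  by (simp add: ptrace_fst_def dagger_def vec_eq_iff)

section \<open>Hermiticity of \<open>B_op\<close> and the extracted energy as its quadratic
  form\<close>

lemma hermitian_Z_op: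
  fixes \<rho> :: "complex ^ ('b::finite \<times> 'k::finite) ^ ('b \<times> 'k)"
  assumes "hermitian \<rho>" "hermitian H"
  shows "hermitian (Z_op \<rho> H)"
proof -
  have "dagger (mat c :: complex ^ ('b \<times> 'k) ^ ('b \<times> 'k)) = mat (cnj c)" for c
    by (simp add: dagger_def mat_def vec_eq_iff)
  moreover have "dagger (X - Y) = dagger X - dagger Y" for X Y :: "complex ^ ('b \<times> 'k) ^ ('b \<times> 'k)"
    by (simp add: dagger_def vec_eq_iff)
  moreover have "dagger (tensor H (mat 1 :: complex ^ 'k ^ 'k)) = tensor (dagger H) (mat 1)"
    by (simp add: dagger_def tensor_def mat_def vec_eq_iff)
  moreover have "cnj (trace (ptrace_snd \<rho> ** H)) = trace (ptrace_snd \<rho> ** H)"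
    using assms by (intro cnj_trace_hermitian hermitian_ptrace_snd)
  ultimately show ?thesis
    using assms(2) by (simp add: Z_op_def battery_state_def hermitian_def)
qed

lemma hermitian_B_op:
  assumes "hermitian \<rho>" "hermitian H"
  shows "hermitian (B_op \<rho> H)"
proof -
  have "dagger (B_op \<rho> H) = ptrace_fst (Z_op \<rho> H ** \<rho>)"
    using assms hermitian_Z_op[OF assms]
    by (simp add: B_op_def ptrace_fst_dagger dagger_mult hermitian_def)
  \<comment> \<open>The scalar part of \<open>Z_op\<close> commutes with \<open>\<rho>\<close>, and
    its other part acts on the battery alone, so partial cyclicity restores the order of the
    factors.\<close>
  also have "\<dots> = B_op \<rho> H"
    by (simp add: B_op_def Z_op_def matrix_mult_diff_right matrix_mult_diff_left ptrace_fst_diff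
        mat_mult mult_mat ptrace_fst_tensor_cyclic)
  finally show ?thesis by (simp add: hermitian_def)
qed

lemma ketbra_idem:
  assumes "cinner v v = 1"
  shows "ketbra v ** ketbra v = ketbra v"
proof -
  have "(ketbra v ** ketbra v) $ i $ j = v $ i * cinner v v * cnj (v $ j)" for i j
    by (simp add: matrix_matrix_mult_def ketbra_def cinner_def sum_distrib_left
        sum_distrib_right mult_ac)
  then show ?thesis
    by (simp add: assms vec_eq_iff) (simp add: ketbra_def)
qed

text \<open>Normalization makes \<open>P\<close> a projector. Cyclicity of the trace and
  \<open>P ** T = T ** P\<close> then merge its two copies, leaving the trace of
  \<open>\<rho> ** Z_op \<rho> H ** P\<close>.\<close>

lemma extracted_energy_eq:
  fixes \<rho> :: "complex ^ ('b::finite \<times> 'k::finite) ^ ('b \<times> 'k)"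
  assumes "cinner (\<Psi> i) (\<Psi> i) = 1"
  shows "extracted_energy \<rho> H \<Psi> i = Re (cinner (\<Psi> i) (B_op \<rho> H *v \<Psi> i))"
proof -
  define P where "P = tensor (mat 1 :: complex ^ 'b ^ 'b) (ketbra (\<Psi> i))"
  define T where "T = tensor H (mat 1 :: complex ^ 'k ^ 'k)"
  define c where "c = trace (battery_state \<rho> ** H)"
  have PP: "P ** P = P"
    by (simp add: P_def tensor_mult ketbra_idem assms)
  have PT: "P ** T = T ** P"
    by (simp add: P_def T_def tensor_mult)
  have "trace (P ** \<rho> ** P) = trace (\<rho> ** P)"
    by (metis PP matrix_mul_assoc trace_mul_sym)
  moreover have "trace (T ** (P ** \<rho> ** P)) = trace (\<rho> ** T ** P)"
    by (metis PP PT matrix_mul_assoc trace_mul_sym)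
  moreover have "trace (\<rho> ** Z_op \<rho> H ** P) = trace (\<rho> ** P) * c - trace (\<rho> ** T ** P)"
  proof -
    have "\<rho> ** Z_op \<rho> H ** P = mat c ** (\<rho> ** P) - \<rho> ** T ** P"
      by (simp add: Z_op_def T_def c_def matrix_mult_diff_right matrix_mult_diff_left
          matrix_mul_assoc) (simp add: mult_mat mat_mult)
    then show ?thesis
      by (simp add: trace_sub mat_mult) (simp add: trace_def sum_distrib_left mult.commute)
  qed
  moreover have "trace (\<rho> ** Z_op \<rho> H ** P) = cinner (\<Psi> i) (B_op \<rho> H *v \<Psi> i)"
    by (simp add: P_def B_op_def trace_tensor_ketbra)
  ultimately show ?thesis
    by (simp add: extracted_energy_def post_measurement_def trace_mult_ptrace_snd
        P_def T_def c_def)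
qed

section \<open>Optimization over orthonormal bases\<close>

lemma hermitian_spectral_decomposition:
  fixes M :: "complex ^ 'k::finite ^ 'k"
  assumes "hermitian M" "lists_eigenvalues M \<beta>"
  obtains \<Phi> and l :: "'k \<Rightarrow> real" where "orthonormal_on UNIV \<Phi>"
    "\<And>i. M *v \<Phi> i = of_real (l i) *s \<Phi> i"
    "image_mset \<beta> (mset_set UNIV) = image_mset (\<lambda>i. complex_of_real (l i)) (mset_set UNIV)"
proof -
  obtain \<Phi> and l :: "'k \<Rightarrow> real" where on: "orthonormal_on UNIV \<Phi>"
    and eig: "\<And>i. M *v \<Phi> i = of_real (l i) *s \<Phi> i"
    using hermitian_orthonormal_eigenvectors[OF assms(1), of UNIV] by auto
  show ?thesis
    using that[OF on eig]
      lists_eigenvalues_unique[OF assms(2) lists_eigenvalues_orthonormal[OF on eig]] by simp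
qed

text \<open>
  The weights \<open>(cmod (cinner (\<Phi> j) (\<Psi> i)))\<^sup>2\<close> form a doubly stochastic matrix; every bound
  below is an averaging argument over it.
\<close>

lemma quadratic_form_bounds:
  fixes M :: "complex ^ 'k::finite ^ 'k" and \<Phi> \<Psi> :: "'k \<Rightarrow> complex ^ 'k"
  assumes M: "hermitian M"
    and \<Phi>: "orthonormal_on UNIV \<Phi>" and eig: "\<And>i. M *v \<Phi> i = of_real (l i) *s \<Phi> i"
    and \<Psi>: "orthonormal_on UNIV \<Psi>"
  defines "e \<equiv> \<lambda>i. Re (cinner (\<Psi> i) (M *v \<Psi> i))"
  shows "(\<Sum>i\<in>UNIV. e i) = (\<Sum>i\<in>UNIV. l i)"
    and "e i \<le> Max (range l)"
    and "(\<Sum>i\<in>UNIV. max 0 (e i)) \<le> (\<Sum>i\<in>UNIV. max 0 (l i))"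
proof -
  define W where "W i j = (cmod (cinner (\<Phi> j) (\<Psi> i)))\<^sup>2" for i j
  have e: "e i = (\<Sum>j\<in>UNIV. l j * W i j)" for i
    using cinner_spectral[OF M \<Phi> eig, of "\<Psi> i"] by (simp add: e_def W_def)
  have W: "W i j \<ge> 0" for i j
    by (simp add: W_def)
  have row: "(\<Sum>j\<in>UNIV. W i j) = 1" for i
    using sum_cmod_cinner[OF \<Phi>, of "\<Psi> i"] \<Psi> by (simp add: W_def orthonormal_on_def)
  have "cmod (cinner (\<Phi> j) (\<Psi> i)) = cmod (cinner (\<Psi> i) (\<Phi> j))" for i j
    by (metis cnj_cinner complex_mod_cnj)
  then have col: "(\<Sum>i\<in>UNIV. W i j) = 1" for j
    using sum_cmod_cinner[OF \<Psi>, of "\<Phi> j"] \<Phi> by (simp add: W_def orthonormal_on_def)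
  \<comment> \<open>Summed over all outcomes, the weights disappear because each column sums to
    1.\<close>
  have col_sum: "(\<Sum>i\<in>UNIV. \<Sum>j\<in>UNIV. g j * W i j) = (\<Sum>j\<in>UNIV. g j)" for g
    by (subst sum.swap) (simp add: sum_distrib_left[symmetric] col)
  show "(\<Sum>i\<in>UNIV. e i) = (\<Sum>i\<in>UNIV. l i)"
    by (simp add: e col_sum)
  \<comment> \<open>Each \<open>e i\<close> is a convex combination of the eigenvalues, with weights
    from row \<open>i\<close>.\<close>
  have "e i \<le> (\<Sum>j\<in>UNIV. Max (range l) * W i j)"
    unfolding e by (intro sum_mono mult_right_mono W) simp
  then show "e i \<le> Max (range l)"
    by (simp add: sum_distrib_left[symmetric] row)
  \<comment> \<open>Jensen's inequality for the convex function \<open>max 0\<close>, proved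
    directly from nonnegativity of the weights.\<close>
  have "max 0 (e i) \<le> (\<Sum>j\<in>UNIV. max 0 (l j) * W i j)" for i
    unfolding e using W by (auto intro!: sum_mono mult_right_mono sum_nonneg)
  then have "(\<Sum>i\<in>UNIV. max 0 (e i)) \<le> (\<Sum>i\<in>UNIV. \<Sum>j\<in>UNIV. max 0 (l j) * W i j)"
    by (intro sum_mono)
  then show "(\<Sum>i\<in>UNIV. max 0 (e i)) \<le> (\<Sum>i\<in>UNIV. max 0 (l i))"
    by (simp add: col_sum)
qed

lemma has_maximum_Greatest:
  assumes "m \<in> A" "\<And>x. x \<in> A \<Longrightarrow> x \<le> m"
  shows "has_maximum A" "(GREATEST s. s \<in> A) = m"
proof -
  show "has_maximum A"
    using assms unfolding has_maximum_def by blast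
  show "(GREATEST s. s \<in> A) = m"
    by (rule Greatest_equality) (use assms in auto)
qed

text \<open>The listing \<open>\<beta>\<close> is complex because it comes from a factorization of
  \<open>charpoly\<close>; its reality is part of the conclusion, so that taking \<open>Re\<close>
  loses nothing.\<close>

theorem theorem3:
  fixes H\<^sub>B :: "complex ^ 'b ^ 'b"
    and \<rho> :: "complex ^ ('b::finite \<times> 'a::finite \<times> 'e::finite \<times> 'x::finite) ^ ('b \<times> 'a \<times> 'e \<times> 'x)"
    and \<beta> :: "'a \<times> 'e \<times> 'x \<Rightarrow> complex"
  assumes "hermitian H\<^sub>B"
    and "density_operator \<rho>"
    and "\<not> product_state_BAE_X \<rho>"
    and "lists_eigenvalues (B_op \<rho> H\<^sub>B) \<beta>"
  shows "(\<forall>i. \<beta> i \<in> \<real>)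
    \<and> has_maximum (distillable_values \<rho> H\<^sub>B)
    \<and> S_NP2_D \<rho> H\<^sub>B = (\<Sum>i | 0 < Re (\<beta> i). Re (\<beta> i))
    \<and> has_maximum (stochastic_values \<rho> H\<^sub>B)
    \<and> S_NP2_max \<rho> H\<^sub>B = Max (range (\<lambda>i. Re (\<beta> i)))
    \<and> has_maximum (average_values \<rho> H\<^sub>B)
    \<and> S_NP2_av \<rho> H\<^sub>B = (\<Sum>i\<in>UNIV. Re (\<beta> i))"
proof -
  let ?B = "B_op \<rho> H\<^sub>B"
  have B: "hermitian ?B"
    using assms(1,2) by (simp add: hermitian_B_op density_operator_def)
  obtain \<Phi> and l :: "'a \<times> 'e \<times> 'x \<Rightarrow> real" where \<Phi>: "orthonormal_on UNIV \<Phi>"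
    and eig: "\<And>i. ?B *v \<Phi> i = of_real (l i) *s \<Phi> i"
    and mset: "image_mset \<beta> (mset_set UNIV) = image_mset (\<lambda>i. complex_of_real (l i)) (mset_set UNIV)"
    using hermitian_spectral_decomposition[OF B assms(4)] by blast
  have range_\<beta>: "range \<beta> = range (\<lambda>i. complex_of_real (l i))"
    using arg_cong[OF mset, of set_mset] by simp
  have range_Re: "range (\<lambda>i. Re (\<beta> i)) = range l"
    using arg_cong[OF range_\<beta>, of "image Re"] by (simp add: image_image)
  \<comment> \<open>\<open>\<beta>\<close> and \<open>l\<close> agree as multisets but perhaps not
    index by index, so sums are transferred through the multiset.\<close>
  have sum_\<beta>: "(\<Sum>i\<in>UNIV. F (Re (\<beta> i))) = (\<Sum>i\<in>UNIV. F (l i))" for F :: "real \<Rightarrow> real"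
    using arg_cong[OF mset, of "\<lambda>A. \<Sum>x\<in>#A. F (Re x)"]
    by (simp add: sum_unfold_sum_mset image_mset.compositionality comp_def)
  \<comment> \<open>Positive parts replace an index set that depends on the basis by a sum over all
    indices.\<close>
  have pos: "(\<Sum>i | 0 < g i. g i) = (\<Sum>i\<in>UNIV. max 0 (g i))" for g :: "'a \<times> 'e \<times> 'x \<Rightarrow> real"
    by (rule sum.mono_neutral_cong_left) auto
  have unit: "cinner (\<Psi> i) (\<Psi> i) = 1" if "orthonormal_on UNIV \<Psi>"
    for \<Psi> :: "'a \<times> 'e \<times> 'x \<Rightarrow> complex ^ ('a \<times> 'e \<times> 'x)" and i
    using that unfolding orthonormal_on_def by (metis UNIV_I)
  have energy: "extracted_energy \<rho> H\<^sub>B \<Psi> = (\<lambda>i. Re (cinner (\<Psi> i) (?B *v \<Psi> i)))"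
    if "orthonormal_on UNIV \<Psi>" for \<Psi>
    by (intro ext extracted_energy_eq unit that)
  \<comment> \<open>Measuring in the eigenbasis yields exactly the eigenvalues, so
    \<open>\<Phi>\<close> is the common witness for all three maxima.\<close>
  have energy_\<Phi>: "extracted_energy \<rho> H\<^sub>B \<Phi> = l"
    using \<Phi> by (simp add: energy eig cinner_scale_right unit)
  note bounds = quadratic_form_bounds[OF B \<Phi> eig]
  have D: "(\<Sum>i\<in>UNIV. max 0 (l i)) \<in> distillable_values \<rho> H\<^sub>B"
    "\<And>x. x \<in> distillable_values \<rho> H\<^sub>B \<Longrightarrow> x \<le> (\<Sum>i\<in>UNIV. max 0 (l i))"
    using \<Phi> energy_\<Phi> bounds(3)
    by (auto simp: distillable_values_def orthonormal_basis_iff pos energy intro!: exI[of _ \<Phi>])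
  have S: "Max (range l) \<in> stochastic_values \<rho> H\<^sub>B"
    "\<And>x. x \<in> stochastic_values \<rho> H\<^sub>B \<Longrightarrow> x \<le> Max (range l)"
    using \<Phi> energy_\<Phi> bounds(2)
    by (auto simp: stochastic_values_def orthonormal_basis_iff energy intro!: exI[of _ \<Phi>])
  \<comment> \<open>The average is the same for every basis, so \<open>average_values\<close>
    contains a single number.\<close>
  have sum_energy: "(\<Sum>i\<in>UNIV. extracted_energy \<rho> H\<^sub>B \<Psi> i) = (\<Sum>i\<in>UNIV. l i)"
    if "orthonormal_on UNIV \<Psi>" for \<Psi>
    unfolding energy[OF that] by (rule bounds(1)[OF that])
  have A: "(\<Sum>i\<in>UNIV. l i) \<in> average_values \<rho> H\<^sub>B"
    unfolding average_values_def orthonormal_basis_iff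
    using \<Phi> sum_energy[OF \<Phi>, symmetric] by blast
  have A': "x \<le> (\<Sum>i\<in>UNIV. l i)" if "x \<in> average_values \<rho> H\<^sub>B" for x
    using that unfolding average_values_def orthonormal_basis_iff by (auto simp: sum_energy)
  have "\<beta> i \<in> \<real>" for i
    using rangeI[of \<beta> i] unfolding range_\<beta> by auto
  moreover have "(\<Sum>i | 0 < Re (\<beta> i). Re (\<beta> i)) = (\<Sum>i\<in>UNIV. max 0 (l i))"
    by (simp add: pos sum_\<beta>)
  ultimately show ?thesis
    using has_maximum_Greatest[OF D] has_maximum_Greatest[OF S] has_maximum_Greatest[OF A A']
      sum_\<beta>[of "\<lambda>x. x"]
    by (simp add: S_NP2_D_def S_NP2_max_def S_NP2_av_def range_Re)
qed

end
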